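(* Let $\mathcal{H}$ be a complex Hilbert space and let $L,M$ be closed linear subspaces of $\mathcal{H}$ such that, with $Q=L\cap M$, both $L\ominus Q$ and $M\ominus Q$ are non-zero. In order that every functional $f\in F_Q$ have an extension $\tilde f\in F_M\subset\mathcal{H}^*$ (i.e. that there be a mapping $f\mapsto\tilde f$ of $F_Q$ to $F_M$, with a finite constant $A=A(L,M)$ not depending on $f\in F_Q$ in the definition of $F_M$), it is necessary and sufficient that the inclination $c(L,M)$ of the subspaces $L$ and $M$ satisfy the inequality $c(L,M)<1$. Moreover, if $\tilde f\in F_M$ is an extension of $f\in F_Q$, then $$\|\tilde f\|_{\mathcal{H}^*}\le\frac{1}{\sqrt{1-c^2(L,M)}}\,\|f\|_{L^*}.$$
   Context: For closed subspaces $L,M$ of a Hilbert space $\mathcal{H}$ with scalar product $(\cdot,\cdot)$ and norm $\|\cdot\|$, put $Q=L\cap M$; $L\ominus Q$ and $M\ominus Q$ denote the orthogonal complements of $Q$ in $L$ and in $M$ respectively. The case $Q=\{0\}$ is allowed; it is assumed that $L\ominus Q\neq\{0\}$ and $M\ominus Q\neq\{0\}$ (so neither of $L,M$ contains the other). The inclination of $L$ and $M$ is $$c(L,M)=\sup\left\{\frac{|(u,v)|}{\|u\|\,\|v\|} : 0\ne u\in L\ominus Q,\ 0\neq v\in M\ominus Q\right\}\in[0,1].$$ $L^*$ and $\mathcal{H}^*$ denote the spaces of continuous linear functionals on $L$ and $\mathcal{H}$ with the usual operator norms. The set $F_Q$ is $$F_Q=\{f\in L^*: f(x)=0 \text{ for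 } x\in Q\}.$$ The set $F_M$ consists of the functionals $\tilde f\in\mathcal{H}^*$ that extend functionals $f\in F_Q$ in the following sense: $\tilde f(x)=f(x)$ for $x\in L$, $\tilde f(x)=0$ for $x\in M$, and $\|\tilde f\|_{\mathcal{H}^*}\le A\|f\|_{L^*}$, where $A=A(L,M)<\infty$ does not depend on $f\in F_Q$.
   Formalization: The final bound fails for arbitrary A (extensions are free on the orthogonal complement of L+M); it is stated for c(L,M)<1, in the H*-norm when A is the least admissible constant (shown to be attained), and for every A for the norm of the extension restricted to L+M. *)

theory Defs
  imports "HOL-Analysis.Analysis"
begin

text \<open>Complex Hilbert spaces. Topology, norm, and completeness come from \<^class>\<open>banach\<close>; the
  scalar product is linear in its first argument and induces the norm.\<close>

class complex_hilbert = banach +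
  fixes scaleC :: "complex \<Rightarrow> 'a \<Rightarrow> 'a" (infixr "*\<^sub>C" 75)
    and cinner :: "'a \<Rightarrow> 'a \<Rightarrow> complex"
  assumes scaleC_add_right: "a *\<^sub>C (x + y) = a *\<^sub>C x + a *\<^sub>C y"
    and scaleC_add_left: "(a + b) *\<^sub>C x = a *\<^sub>C x + b *\<^sub>C x"
    and scaleC_scaleC: "a *\<^sub>C b *\<^sub>C x = (a * b) *\<^sub>C x"
    and scaleC_of_real: "complex_of_real r *\<^sub>C x = r *\<^sub>R x"
    and cinner_commute: "cinner x y = cnj (cinner y x)"
    and cinner_add_left: "cinner (x + y) z = cinner x z + cinner y z"
    and cinner_scaleC_left: "cinner (a *\<^sub>C x) y = a * cinner x y"
    and norm_eq_sqrt_cinner: "norm x = sqrt (Re (cinner x x))"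

lemma vector_space_scaleC: "vector_space (scaleC :: complex \<Rightarrow> 'a \<Rightarrow> 'a::complex_hilbert)"
proof
  show "1 *\<^sub>C x = x" for x :: 'a
    using scaleC_of_real[of 1 x] by simp
qed (simp_all add: scaleC_add_right scaleC_add_left scaleC_scaleC)

abbreviation csubspace :: "'a::complex_hilbert set \<Rightarrow> bool"
  where "csubspace \<equiv> module.subspace scaleC"

definition ominus :: "'a::complex_hilbert set \<Rightarrow> 'a set \<Rightarrow> 'a set" (infixl "\<ominus>" 65)
  where "L \<ominus> Q = {x \<in> L. \<forall>q\<in>Q. cinner x q = 0}"

definition inclination :: "'a::complex_hilbert set \<Rightarrow> 'a set \<Rightarrow> real"
  where "inclination L M =
    Sup {cmod (cinner u v) / (norm u * norm v) |u v.
          u \<in> L \<ominus> (L \<inter> M) \<and> u \<noteq> 0 \<and> v \<in> M \<ominus> (L \<inter> M) \<and> v \<noteq> 0}"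

text \<open>The continuous linear functionals on a subspace \<open>S\<close> are functions on the whole type with the
  value \<^const>\<open>undefined\<close> outside \<open>S\<close>, so that equality of functionals is equality on \<open>S\<close>.\<close>

definition dual :: "'a::complex_hilbert set \<Rightarrow> ('a \<Rightarrow> complex) set"
  where "dual S = {f \<in> extensional S.
    (\<forall>x\<in>S. \<forall>y\<in>S. f (x + y) = f x + f y) \<and>
    (\<forall>a. \<forall>x\<in>S. f (a *\<^sub>C x) = a * f x) \<and>
    continuous_on S f}"

text \<open>The quotient is \<open>0\<close> at \<open>x = 0\<close>, as in \<^const>\<open>onorm\<close>.\<close>

definition dual_norm :: "'a::complex_hilbert set \<Rightarrow> ('a \<Rightarrow> complex) \<Rightarrow> real"
  where "dual_norm S f = (SUP x\<in>S. cmod (f x) / norm x)"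

lemma dual_norm_UNIV: "dual_norm UNIV f = onorm f"
  by (simp add: dual_norm_def onorm_def)

definition F_Q :: "'a::complex_hilbert set \<Rightarrow> 'a set \<Rightarrow> ('a \<Rightarrow> complex) set"
  where "F_Q L M = {f \<in> dual L. \<forall>x\<in>L \<inter> M. f x = 0}"

definition F_M :: "'a::complex_hilbert set \<Rightarrow> 'a set \<Rightarrow> real \<Rightarrow> ('a \<Rightarrow> complex) set"
  where "F_M L M A = {g \<in> dual UNIV. \<exists>f\<in>F_Q L M.
    (\<forall>x\<in>L. g x = f x) \<and> (\<forall>x\<in>M. g x = 0) \<and> dual_norm UNIV g \<le> A * dual_norm L f}"

definition admissible :: "'a::complex_hilbert set \<Rightarrow> 'a set \<Rightarrow> real \<Rightarrow> bool"
  where "admissible L M A \<longleftrightarrow>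
    (\<exists>E \<in> F_Q L M \<rightarrow> F_M L M A. \<forall>f\<in>F_Q L M. \<forall>x\<in>L. E f x = f x)"

text \<open>The constant \<open>A(L,M)\<close> of the estimate for extensions. An extension is arbitrary on the
  orthogonal complement of \<open>L + M\<close>, so an explicit bound for the norm of all members of
  \<^term>\<open>F_M L M A\<close> is possible only if \<open>A\<close> is taken as small as possible.\<close>

definition ext_const :: "'a::complex_hilbert set \<Rightarrow> 'a set \<Rightarrow> real"
  where "ext_const L M = Inf {A. admissible L M A}"

end

theory Submission
  imports Defs
begin

text \<open>Splitting off the components in \<open>Q\<close> shows
  \<open>(1 - c\<^sup>2) \<parallel>u\<^sub>0\<parallel>\<^sup>2 \<le> \<parallel>u + v\<parallel>\<^sup>2\<close> for \<open>u \<in> L\<close>, \<open>v \<in> M\<close>, where \<open>u\<^sub>0\<close> is the component of \<open>u\<close> in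
  \<open>L \<ominus> Q\<close>. Hence \<open>u + v \<mapsto> f u\<close> is a bounded functional on \<open>L + M\<close>, and its Riesz representative is an
  extension of least norm. Admissibility of \<open>A\<close> thus amounts to the estimate
  \<open>\<bar>f u\<bar> \<le> A \<parallel>f\<parallel> \<parallel>u + v\<parallel>\<close>, a condition that is closed in \<open>A\<close>. Conversely, that estimate for
  \<open>f = (\<cdot>, u)\<close>, with \<open>- v\<close> the projection of \<open>u\<close> to a line in \<open>M \<ominus> Q\<close>, bounds the cosine of the
  angle by \<open>sqrt (1 - 1 / A\<^sup>2)\<close>.\<close>

section \<open>Complex subspaces\<close>

lemma csubspace_iff:
  "csubspace S \<longleftrightarrow> 0 \<in> S \<and> (\<forall>x\<in>S. \<forall>y\<in>S. x + y \<in> S) \<and> (\<forall>a. \<forall>x\<in>S. a *\<^sub>C x \<in> S)"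
  by (simp add: module.subspace_def[OF vector_space_scaleC[folded module_iff_vector_space]])

lemma csubspace_0: "csubspace S \<Longrightarrow> 0 \<in> S"
  and csubspace_add: "csubspace S \<Longrightarrow> x \<in> S \<Longrightarrow> y \<in> S \<Longrightarrow> x + y \<in> S"
  and csubspace_scaleC: "csubspace S \<Longrightarrow> x \<in> S \<Longrightarrow> a *\<^sub>C x \<in> S"
  by (auto simp: csubspace_iff)

lemma csubspace_scaleR: "csubspace S \<Longrightarrow> x \<in> S \<Longrightarrow> r *\<^sub>R x \<in> S"
  by (metis csubspace_scaleC scaleC_of_real)

lemma csubspace_uminus: "csubspace S \<Longrightarrow> x \<in> S \<Longrightarrow> - x \<in> S"
  using csubspace_scaleR[of S x "-1"] by simp

lemma csubspace_diff: "csubspace S \<Longrightarrow> x \<in> S \<Longrightarrow> y \<in> S \<Longrightarrow> x - y \<in> S"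
  using csubspace_add[of S x "- y"] csubspace_uminus by auto

lemma csubspace_Int: "csubspace L \<Longrightarrow> csubspace M \<Longrightarrow> csubspace (L \<inter> M)"
  by (auto simp: csubspace_iff)

lemma csubspace_sum:
  assumes "csubspace L" "csubspace M"
  shows "csubspace {u + v |u v. u \<in> L \<and> v \<in> M}"
  unfolding csubspace_iff
proof (intro conjI ballI allI)
  show "0 \<in> {u + v |u v. u \<in> L \<and> v \<in> M}"
    using assms csubspace_0 by force
next
  fix x y assume "x \<in> {u + v |u v. u \<in> L \<and> v \<in> M}" "y \<in> {u + v |u v. u \<in> L \<and> v \<in> M}"
  then obtain a b c d where "x = a + b" "y = c + d" "a \<in> L" "c \<in> L" "b \<in> M" "d \<in> M"
    by blast
  moreover from this have "x + y = (a + c) + (b + d)" by simp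
  ultimately show "x + y \<in> {u + v |u v. u \<in> L \<and> v \<in> M}"
    using assms csubspace_add by blast
next
  fix a x assume "x \<in> {u + v |u v. u \<in> L \<and> v \<in> M}"
  then show "a *\<^sub>C x \<in> {u + v |u v. u \<in> L \<and> v \<in> M}"
    using assms csubspace_scaleC scaleC_add_right by blast
qed

section \<open>The scalar product and the Cauchy-Schwarz inequality\<close>

lemma cinner_add_right: "cinner x (y + z) = cinner x y + cinner x z"
  by (metis cinner_add_left cinner_commute complex_cnj_add)

lemma cinner_scaleC_right: "cinner x (a *\<^sub>C y) = cnj a * cinner x y"
  by (metis cinner_scaleC_left cinner_commute complex_cnj_mult)

lemma cinner_scaleR_left: "cinner (r *\<^sub>R x) y = of_real r * cinner x y"
  by (metis cinner_scaleC_left scaleC_of_real)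

lemma cinner_scaleR_right: "cinner x (r *\<^sub>R y) = of_real r * cinner x y"
  by (metis cinner_scaleC_right scaleC_of_real complex_cnj_complex_of_real)

lemma cinner_minus_left: "cinner (- x) y = - cinner x y"
  using cinner_scaleR_left[of "-1" x y] by simp

lemma cinner_minus_right: "cinner x (- y) = - cinner x y"
  using cinner_scaleR_right[of x "-1" y] by simp

lemma cinner_diff_left: "cinner (x - y) z = cinner x z - cinner y z"
  using cinner_add_left[of x "- y" z] by (simp add: cinner_minus_left)

lemma cinner_0_left [simp]: "cinner 0 y = 0"
  using cinner_scaleR_left[of 0 0 y] by simp

lemma cinner_0_right [simp]: "cinner x 0 = 0"
  using cinner_scaleR_right[of x 0 0] by simp

lemma cinner_self: "cinner x x = of_real ((norm x)\<^sup>2)"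
proof -
  have "Im (cinner x x) = 0"
    using cinner_commute[of x x] by (simp add: complex_eq_iff)
  \<comment> \<open>Positivity is extracted from \<open>0 \<le> norm x\<close>: \<open>sqrt\<close>
    is an odd function on the reals, hence negative at negative arguments.\<close>
  moreover have "Re (cinner x x) \<ge> 0"
    using norm_ge_zero[of x] by (subst (asm) norm_eq_sqrt_cinner) simp
  then have "Re (cinner x x) = (norm x)\<^sup>2"
    by (subst norm_eq_sqrt_cinner) simp
  ultimately show ?thesis by (simp add: complex_eq_iff)
qed

lemma norm_add_sq: "(norm (x + y))\<^sup>2 = (norm x)\<^sup>2 + (norm y)\<^sup>2 + 2 * Re (cinner x y)"
  for x y :: "'a::complex_hilbert"
proof -
  have "Re (cinner (x + y) (x + y)) = Re (cinner x x) + Re (cinner y y) + 2 * Re (cinner x y)"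
    using cinner_commute[of y x] by (simp add: cinner_add_left cinner_add_right)
  then show ?thesis by (simp add: cinner_self)
qed

lemma norm_add_sq_orthogonal:
  "cinner x y = 0 \<Longrightarrow> (norm (x + y))\<^sup>2 = (norm x)\<^sup>2 + (norm y)\<^sup>2"
  by (simp add: norm_add_sq)

text \<open>Pythagoras for the projection of \<open>x\<close> to the line through \<open>y\<close>,
  which has norm \<open>cmod (cinner x y) / norm y\<close>. It serves twice: for Cauchy-Schwarz, and
  for bounding the cosine of an angle by a distance.\<close>

lemma norm_sq_diff_projection:
  fixes x y :: "'a::complex_hilbert"
  assumes "y \<noteq> 0"
  shows "(norm (x - (cinner x y / of_real ((norm y)\<^sup>2)) *\<^sub>C y))\<^sup>2
    = (norm x)\<^sup>2 - (cmod (cinner x y) / norm y)\<^sup>2"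
proof -
  define p where "p = (cinner x y / of_real ((norm y)\<^sup>2)) *\<^sub>C y"
  have "cinner (x - p) y = 0"
    using assms by (simp add: p_def cinner_diff_left cinner_scaleC_left cinner_self)
  then have "cinner (x - p) p = 0"
    by (simp add: p_def cinner_scaleC_right)
  then have "(norm x)\<^sup>2 = (norm (x - p))\<^sup>2 + (norm p)\<^sup>2"
    using norm_add_sq_orthogonal[of "x - p" p] by simp
  moreover have "complex_of_real ((norm p)\<^sup>2) = of_real ((cmod (cinner x y) / norm y)\<^sup>2)"
  proof -
    have "complex_of_real ((norm p)\<^sup>2) = cinner p p" by (simp add: cinner_self)
    also have "\<dots> = (cinner x y * cnj (cinner x y)) / of_real ((norm y)\<^sup>2)"
      unfolding p_def cinner_scaleC_left cinner_scaleC_right cinner_self[of y]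
      using assms by (simp add: field_simps power2_eq_square)
    also have "\<dots> = of_real ((cmod (cinner x y) / norm y)\<^sup>2)"
      by (simp add: complex_norm_square[symmetric] power_divide)
    finally show ?thesis .
  qed
  ultimately show ?thesis
    unfolding p_def[symmetric] using of_real_eq_iff by (metis add_diff_cancel_right')
qed

text \<open>The squared distance from \<open>x\<close> to the line through \<open>y\<close> is
  nonnegative.\<close>

lemma cinner_Cauchy_Schwarz: "cmod (cinner x y) \<le> norm x * norm y"
  for x y :: "'a::complex_hilbert"
proof (cases "y = 0")
  case False
  have "0 \<le> (norm x)\<^sup>2 - (cmod (cinner x y) / norm y)\<^sup>2"
    using norm_sq_diff_projection[OF False, of x] by (metis zero_le_power2)
  then have "(cmod (cinner x y) / norm y)\<^sup>2 \<le> (norm x)\<^sup>2" by linarith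
  then have "cmod (cinner x y) / norm y \<le> norm x"
    using norm_ge_zero by (rule power2_le_imp_le)
  with False show ?thesis by (simp add: field_simps)
qed simp

lemma bounded_linear_cinner_left: "bounded_linear (\<lambda>x. cinner x y)"
  by (rule bounded_linear_intro[where K = "norm y"])
    (simp_all add: cinner_add_left cinner_scaleR_left cinner_Cauchy_Schwarz scaleR_conv_of_real)

text \<open>The map is conjugate linear, but \<open>bounded_linear\<close> refers to real scalars,
  so limits can be taken in this argument as well.\<close>

lemma bounded_linear_cinner_right: "bounded_linear (\<lambda>y. cinner x y)"
  by (rule bounded_linear_intro[where K = "norm x"])
    (use cinner_Cauchy_Schwarz[of x] in
      \<open>simp_all add: cinner_add_right cinner_scaleR_right scaleR_conv_of_real mult.commute\<close>)

section \<open>Riesz representation and orthogonal decomposition\<close>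

lemma nonneg_quadratic_imp_linear_coeff_0:
  fixes p a :: real
  assumes "\<And>t. 0 \<le> t\<^sup>2 * p + 2 * t * a" and "0 \<le> p"
  shows "a = 0"
proof -
  \<comment> \<open>The denominator \<open>p + 1\<close> instead of the minimizer's \<open>p\<close>
    covers \<open>p = 0\<close> too; the value is still negative unless
    \<open>a = 0\<close>.\<close>
  have "0 \<le> (- a / (p + 1))\<^sup>2 * p + 2 * (- a / (p + 1)) * a" by (rule assms)
  also have "\<dots> = - (a\<^sup>2 * (p + 2)) / (p + 1)\<^sup>2"
    using assms(2) by (simp add: divide_simps) (simp add: algebra_simps power2_eq_square)
  finally have "0 \<le> - (a\<^sup>2 * (p + 2)) / (p + 1)\<^sup>2" .
  then have "a\<^sup>2 * (p + 2) \<le> 0"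
    using assms(2) by (auto simp: divide_le_0_iff dest: power_eq_0_iff[THEN iffD1])
  with assms(2) show ?thesis
    by (simp add: mult_le_0_iff)
qed

text \<open>The representative is the limit of a minimizing sequence of \<open>\<parallel>x\<parallel>\<^sup>2 - 2 Re (\<phi> x)\<close>; the
  subspace need not be closed.\<close>

lemma Riesz_representation_subspace:
  fixes S :: "'a::complex_hilbert set" and \<phi> :: "'a \<Rightarrow> complex"
  assumes S: "csubspace S"
    and add: "\<And>x y. x \<in> S \<Longrightarrow> y \<in> S \<Longrightarrow> \<phi> (x + y) = \<phi> x + \<phi> y"
    and scale: "\<And>a x. x \<in> S \<Longrightarrow> \<phi> (a *\<^sub>C x) = a * \<phi> x"
    and bound: "\<And>x. x \<in> S \<Longrightarrow> cmod (\<phi> x) \<le> B * norm x"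
    and "0 \<le> B"
  obtains w where "w \<in> closure S" "\<And>y. y \<in> S \<Longrightarrow> \<phi> y = cinner y w" "norm w \<le> B"
proof -
  \<comment> \<open>If \<open>\<phi>\<close> is represented by \<open>w\<close>, then
    \<open>J x\<close> is \<open>(norm (x - w))\<^sup>2 - (norm w)\<^sup>2\<close>, so minimizing
    \<open>J\<close> means approximating \<open>w\<close>.\<close>
  define J where "J x = (norm x)\<^sup>2 - 2 * Re (\<phi> x)" for x
  define m where "m = Inf (J ` S)"
  have scaleR: "\<phi> (r *\<^sub>R x) = of_real r * \<phi> x" if "x \<in> S" for r x
    using scale[OF that, of "of_real r"] by (simp add: scaleC_of_real)
  have J_lower: "- B\<^sup>2 \<le> J x" if "x \<in> S" for x
  proof -
    have "Re (\<phi> x) \<le> B * norm x"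
      using bound[OF that] complex_Re_le_cmod order_trans by blast
    \<comment> \<open>Completing the square bounds \<open>J\<close> from below.\<close>
    moreover have "0 \<le> (norm x - B)\<^sup>2" by simp
    ultimately show ?thesis by (simp add: J_def power2_diff algebra_simps)
  qed
  have bdd: "bdd_below (J ` S)"
    using J_lower by (rule bdd_belowI2)
  have m_le: "m \<le> J x" if "x \<in> S" for x
    unfolding m_def using bdd that by (rule cINF_lower)
  have "\<exists>x\<in>S. J x < m + 1 / real (Suc n)" for n
  proof -
    have "Inf (J ` S) < m + 1 / real (Suc n)" by (simp add: m_def)
    then show ?thesis
      using cInf_lessD[of "J ` S"] csubspace_0[OF S] by auto
  qed
  then obtain X where X: "\<And>n. X n \<in> S" "\<And>n. J (X n) < m + 1 / real (Suc n)"
    by metis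
  \<comment> \<open>The parallelogram law; the contributions of \<open>\<phi>\<close>
    cancel.\<close>
  have J_mid: "(norm (x - y))\<^sup>2 = 2 * J x + 2 * J y - 4 * J ((1/2) *\<^sub>R (x + y))"
    if "x \<in> S" "y \<in> S" for x y
  proof -
    have "(norm (x - y))\<^sup>2 = (norm x)\<^sup>2 + (norm y)\<^sup>2 - 2 * Re (cinner x y)"
      using norm_add_sq[of x "- y"] by (simp add: cinner_minus_right)
    moreover have "J ((1/2) *\<^sub>R (x + y))
        = ((norm x)\<^sup>2 + (norm y)\<^sup>2 + 2 * Re (cinner x y)) / 4 - Re (\<phi> x) - Re (\<phi> y)"
      using that by (simp add: J_def scaleR csubspace_add[OF S] add power_divide norm_add_sq
          diff_divide_distrib add_divide_distrib)
    ultimately show ?thesis by (simp add: J_def field_simps)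
  qed
  \<comment> \<open>The midpoint has \<open>J\<close> at least \<open>m\<close>, while the two end
    points exceed \<open>m\<close> by less than \<open>1 / Suc k\<close> and
    \<open>1 / Suc n\<close>.\<close>
  have dist_X: "(norm (X k - X n))\<^sup>2 \<le> 2 / real (Suc k) + 2 / real (Suc n)" for k n
    using J_mid[of "X k" "X n"] X(2)[of k] X(2)[of n]
      m_le[of "(1/2) *\<^sub>R (X k + X n)"] X(1) S
    by (simp add: csubspace_add csubspace_scaleR)
  have "Cauchy X"
  proof (rule CauchyI)
    fix e :: real assume "0 < e"
    then obtain N where N: "inverse (real (Suc N)) < e\<^sup>2 / 4"
      using reals_Archimedean[of "e\<^sup>2 / 4"] by auto
    have "norm (X k - X n) < e" if "k \<ge> N" "n \<ge> N" for k n
    proof -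
      have "1 / real (Suc k) \<le> inverse (real (Suc N))" "1 / real (Suc n) \<le> inverse (real (Suc N))"
        using that by (simp_all add: inverse_eq_divide frac_le)
      with dist_X[of k n] N have "(norm (X k - X n))\<^sup>2 < e\<^sup>2" by simp
      with \<open>0 < e\<close> show ?thesis by (intro power2_less_imp_less[of _ e]) simp_all
    qed
    then show "\<exists>N. \<forall>k\<ge>N. \<forall>n\<ge>N. norm (X k - X n) < e" by blast
  qed
  then obtain w where w: "X \<longlonglongrightarrow> w"
    using Cauchy_convergent_iff convergent_def by blast
  have w_cl: "w \<in> closure S"
    using X(1) w closure_sequential by blast
  \<comment> \<open>First variation in the direction \<open>y\<close>. As \<open>w\<close> may lie
    outside \<open>S\<close>, where nothing is known about \<open>\<phi>\<close>, the variation is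
    made at \<open>X n\<close>, which is minimal up to \<open>1 / Suc n\<close>, and the limit is
    taken afterwards.\<close>
  have Re_eq: "Re (\<phi> y) = Re (cinner y w)" if y: "y \<in> S" for y
  proof -
    have "0 \<le> t\<^sup>2 * (norm y)\<^sup>2 + 2 * t * (Re (cinner y w) - Re (\<phi> y))" for t
    proof (rule LIMSEQ_le_const)
      show "(\<lambda>n. 1 / real (Suc n) + t\<^sup>2 * (norm y)\<^sup>2 + 2 * t * (Re (cinner y (X n)) - Re (\<phi> y)))
          \<longlonglongrightarrow> t\<^sup>2 * (norm y)\<^sup>2 + 2 * t * (Re (cinner y w) - Re (\<phi> y))"
      proof -
        have "(\<lambda>n. 1 / real (Suc n)) \<longlonglongrightarrow> 0"
          using LIMSEQ_inverse_real_of_nat by (simp add: inverse_eq_divide)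
        then have "(\<lambda>n. 1 / real (Suc n) + t\<^sup>2 * (norm y)\<^sup>2
            + 2 * t * (Re (cinner y (X n)) - Re (\<phi> y)))
          \<longlonglongrightarrow> 0 + t\<^sup>2 * (norm y)\<^sup>2 + 2 * t * (Re (cinner y w) - Re (\<phi> y))"
          by (intro tendsto_intros bounded_linear.tendsto[OF bounded_linear_cinner_right] w)
        then show ?thesis by simp
      qed
      have "0 \<le> 1 / real (Suc n) + t\<^sup>2 * (norm y)\<^sup>2 + 2 * t * (Re (cinner y (X n)) - Re (\<phi> y))" for n
      proof -
        have "J (X n + t *\<^sub>R y)
            = J (X n) + t\<^sup>2 * (norm y)\<^sup>2 + 2 * t * (Re (cinner y (X n)) - Re (\<phi> y))"
          using X(1) y cinner_commute[of "X n" y]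
          by (simp add: J_def norm_add_sq add csubspace_scaleR[OF S] scaleR cinner_scaleR_right
              power_mult_distrib algebra_simps)
        with m_le[of "X n + t *\<^sub>R y"] X[of n] y S show ?thesis
          by (simp add: csubspace_add csubspace_scaleR)
      qed
      then show "\<exists>N. \<forall>n\<ge>N. 0 \<le> 1 / real (Suc n) + t\<^sup>2 * (norm y)\<^sup>2
          + 2 * t * (Re (cinner y (X n)) - Re (\<phi> y))" by blast
    qed
    then have "Re (cinner y w) - Re (\<phi> y) = 0"
      by (rule nonneg_quadratic_imp_linear_coeff_0) simp
    then show ?thesis by simp
  qed
  have eq: "\<phi> y = cinner y w" if y: "y \<in> S" for y
  proof (rule complex_eqI)
    show "Re (\<phi> y) = Re (cinner y w)" using y by (rule Re_eq)
    \<comment> \<open>Imaginary parts are, up to sign, the real parts at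
      \<open>\<i> *\<^sub>C y\<close>.\<close>
    show "Im (\<phi> y) = Im (cinner y w)"
      using Re_eq[OF csubspace_scaleC[OF S y, of \<i>]] y by (simp add: scale cinner_scaleC_left)
  qed
  \<comment> \<open>The bound on \<open>\<phi>\<close> is used at \<open>X n \<in> S\<close> and
    carried over to \<open>w\<close> by continuity of the scalar product.\<close>
  have "(norm w)\<^sup>2 \<le> B * norm w"
  proof (rule LIMSEQ_le)
    show "(\<lambda>n. Re (cinner (X n) w)) \<longlonglongrightarrow> (norm w)\<^sup>2"
      using tendsto_Re[OF bounded_linear.tendsto[OF bounded_linear_cinner_left[of w] w]]
      by (simp add: cinner_self)
    show "(\<lambda>n. B * norm (X n)) \<longlonglongrightarrow> B * norm w"
      by (intro tendsto_intros w)
    show "\<exists>N. \<forall>n\<ge>N. Re (cinner (X n) w) \<le> B * norm (X n)"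
      using X(1) bound eq complex_Re_le_cmod order_trans by metis
  qed
  then have "norm w \<le> B"
    using \<open>0 \<le> B\<close> by (cases "w = 0") (simp_all add: power2_eq_square)
  with that w_cl eq show thesis by blast
qed

text \<open>The projection of \<open>x\<close> to \<open>Q\<close> is the Riesz representative of
  \<open>cinner _ x\<close> on \<open>Q\<close>; it belongs to \<open>Q\<close> because
  \<open>Q\<close> is closed.\<close>

lemma orthogonal_decomposition:
  fixes Q :: "'a::complex_hilbert set"
  assumes "csubspace L" "csubspace Q" "closed Q" "Q \<subseteq> L" "x \<in> L"
  obtains q where "q \<in> Q" "x - q \<in> L \<ominus> Q"
proof -
  have "cmod (cinner y x) \<le> norm x * norm y" for y
    using cinner_Cauchy_Schwarz[of y x] by (simp add: mult.commute)
  then obtain w where w: "w \<in> closure Q" "\<And>y. y \<in> Q \<Longrightarrow> cinner y x = cinner y w"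
    using Riesz_representation_subspace[OF assms(2), of "\<lambda>y. cinner y x" "norm x"]
    by (metis cinner_add_left cinner_scaleC_left norm_ge_zero)
  have "w \<in> Q" using w(1) assms(3) by simp
  moreover have "cinner (x - w) q = 0" if "q \<in> Q" for q
    using w(2)[OF that] cinner_commute[of x q] cinner_commute[of w q]
    by (simp add: cinner_diff_left)
  ultimately have "x - w \<in> L \<ominus> Q"
    using assms csubspace_diff by (fastforce simp: ominus_def)
  with \<open>w \<in> Q\<close> show thesis by (rule that)
qed

section \<open>Continuous functionals on a subspace and their norms\<close>

lemma dual_add: "f \<in> dual S \<Longrightarrow> x \<in> S \<Longrightarrow> y \<in> S \<Longrightarrow> f (x + y) = f x + f y"
  and dual_scaleC: "f \<in> dual S \<Longrightarrow> x \<in> S \<Longrightarrow> f (a *\<^sub>C x) = a * f x"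
  by (auto simp: dual_def)

lemma dual_0:
  assumes "csubspace S" "f \<in> dual S"
  shows "f 0 = 0"
  using dual_add[OF assms(2), of 0 0] csubspace_0[OF assms(1)] by simp

lemma dual_scaleR: "f \<in> dual S \<Longrightarrow> x \<in> S \<Longrightarrow> f (r *\<^sub>R x) = of_real r * f x"
  by (metis dual_scaleC scaleC_of_real)

lemma dual_diff:
  assumes "csubspace S" "f \<in> dual S" "x \<in> S" "y \<in> S"
  shows "f (x - y) = f x - f y"
  using dual_add[OF assms(2,3) csubspace_uminus[OF assms(1,4)]]
    dual_scaleR[OF assms(2,4), of "-1"] by simp

text \<open>Continuity at \<open>0\<close> controls \<open>f\<close> on a ball of radius
  \<open>d\<close>, and every nonzero \<open>x\<close> can be rescaled to norm \<open>d / 2\<close>.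
  This makes the supremum in \<open>dual_norm\<close> a genuine upper bound.\<close>

lemma dual_bounded:
  assumes S: "csubspace S" and f: "f \<in> dual S"
  shows "bdd_above ((\<lambda>x. cmod (f x) / norm x) ` S)"
proof -
  have "continuous_on S f" using f by (simp add: dual_def)
  then obtain d where d: "0 < d" "\<And>x. x \<in> S \<Longrightarrow> dist x 0 < d \<Longrightarrow> dist (f x) (f 0) < 1"
    using csubspace_0[OF S] unfolding continuous_on_iff by (metis zero_less_one)
  have "cmod (f x) / norm x \<le> 2 / d" if x: "x \<in> S" for x
  proof (cases "x = 0")
    case False
    define y where "y = (d / (2 * norm x)) *\<^sub>R x"
    have "y \<in> S" "norm y < d"
      using x S d(1) False by (simp_all add: y_def csubspace_scaleR)
    then have "cmod (f y) < 1"
      using d(2)[of y] dual_0[OF S f] by simp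
    moreover have "cmod (f y) = d / 2 * (cmod (f x) / norm x)"
      using d(1) x f by (simp add: y_def dual_scaleR norm_mult norm_divide)
    ultimately have "d / 2 * (cmod (f x) / norm x) < 1" by simp
    then have "cmod (f x) / norm x < 1 / (d / 2)"
      using d(1) by (subst pos_less_divide_eq) (simp_all add: mult.commute)
    then show ?thesis by simp
  qed (use d(1) in simp)
  then show ?thesis by (rule bdd_aboveI2)
qed

lemma norm_le_dual_norm:
  assumes "csubspace S" "f \<in> dual S" "x \<in> S"
  shows "cmod (f x) \<le> dual_norm S f * norm x"
proof (cases "x = 0")
  case False
  have "cmod (f x) / norm x \<le> dual_norm S f"
    using cSUP_upper[OF assms(3) dual_bounded[OF assms(1,2)]] by (simp add: dual_norm_def)
  with False show ?thesis by (simp add: field_simps)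
qed (use assms dual_0 in auto)

text \<open>The quotient at \<open>0\<close> is \<open>0\<close>, and it is one of the values in the
  supremum.\<close>

lemma dual_norm_nonneg:
  assumes "csubspace S" "f \<in> dual S"
  shows "0 \<le> dual_norm S f"
  using cSUP_upper[OF csubspace_0[OF assms(1)] dual_bounded[OF assms]]
  by (simp add: dual_norm_def)

text \<open>Stated for arbitrary functions, so that a functional on \<open>UNIV\<close> can also be
  measured on \<open>L + M\<close> alone.\<close>

lemma dual_norm_le:
  assumes "S \<noteq> {}" "0 \<le> B" "\<And>x. x \<in> S \<Longrightarrow> cmod (f x) \<le> B * norm x"
  shows "dual_norm S f \<le> B"
  unfolding dual_norm_def
proof (rule cSUP_least)
  show "cmod (f x) / norm x \<le> B" if "x \<in> S" for x
    using assms(2) assms(3)[OF that] by (cases "x = 0") (simp_all add: field_simps)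
qed fact

lemma csubspace_UNIV: "csubspace UNIV"
  by (simp add: csubspace_iff)

section \<open>Extensions and admissible constants\<close>

lemma restrict_cinner_in_dual:
  assumes "csubspace S"
  shows "restrict (\<lambda>x. cinner x w) S \<in> dual S"
  using assms bounded_linear.continuous_on[OF bounded_linear_cinner_left continuous_on_id, of S w]
  by (auto simp: dual_def csubspace_add csubspace_scaleC cinner_add_left cinner_scaleC_left
      cong: continuous_on_cong)

text \<open>The only possible values on \<open>L + M\<close> are \<open>u + v \<mapsto> f u\<close>;
  this is well defined because \<open>f\<close> vanishes on \<open>L \<inter> M\<close>. Pairing
  with the Riesz representative makes sense on the whole space and does not increase the norm beyond
  \<open>B\<close>.\<close>

lemma extension_exists:
  fixes L M :: "'a::complex_hilbert set"
  assumes L: "csubspace L" and M: "csubspace M" and f: "f \<in> F_Q L M" and B: "0 \<le> B"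
    and bound: "\<And>u v. u \<in> L \<Longrightarrow> v \<in> M \<Longrightarrow> cmod (f u) \<le> B * norm (u + v)"
  obtains g where "g \<in> dual UNIV" "\<And>x. x \<in> L \<Longrightarrow> g x = f x" "\<And>x. x \<in> M \<Longrightarrow> g x = 0"
    "dual_norm UNIV g \<le> B"
proof -
  let ?S = "{u + v |u v. u \<in> L \<and> v \<in> M}"
  have fd: "f \<in> dual L" and f0: "\<And>x. x \<in> L \<Longrightarrow> x \<in> M \<Longrightarrow> f x = 0"
    using f by (auto simp: F_Q_def)
  define \<phi> where "\<phi> x = f (SOME u. u \<in> L \<and> x - u \<in> M)" for x
  have \<phi>: "\<phi> (u + v) = f u" if uv: "u \<in> L" "v \<in> M" for u v
  proof -
    define u' where "u' = (SOME u'. u' \<in> L \<and> u + v - u' \<in> M)"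
    have "u' \<in> L \<and> u + v - u' \<in> M"
      unfolding u'_def by (rule someI[of _ u]) (use uv in simp)
    then have u': "u' \<in> L" "u + v - u' \<in> M" by auto
    \<comment> \<open>Two components in \<open>L\<close> of the same vector differ by an element of
      \<open>L \<inter> M\<close>.\<close>
    have "u - u' = (u + v - u') - v" by simp
    then have "u - u' \<in> M" using csubspace_diff[OF M u'(2) uv(2)] by simp
    then have "f (u - u') = 0" using f0 csubspace_diff[OF L uv(1) u'(1)] by blast
    then show ?thesis
      using dual_diff[OF L fd uv(1) u'(1)] by (simp add: \<phi>_def u'_def)
  qed
  obtain w where w: "\<And>y. y \<in> ?S \<Longrightarrow> \<phi> y = cinner y w" "norm w \<le> B"
  proof (rule Riesz_representation_subspace[OF csubspace_sum[OF L M], of \<phi> B])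
    fix x y assume "x \<in> ?S" "y \<in> ?S"
    then obtain a b c d where *: "x = a + b" "y = c + d" "a \<in> L" "c \<in> L" "b \<in> M" "d \<in> M"
      by blast
    then have "x + y = (a + c) + (b + d)" by simp
    with * show "\<phi> (x + y) = \<phi> x + \<phi> y"
      by (metis L M \<phi> csubspace_add dual_add fd)
  next
    fix a x assume "x \<in> ?S"
    then show "\<phi> (a *\<^sub>C x) = a * \<phi> x"
      using L M fd by (auto simp: scaleC_add_right \<phi> csubspace_scaleC dual_scaleC)
  next
    fix x assume "x \<in> ?S"
    then show "cmod (\<phi> x) \<le> B * norm x" using \<phi> bound by auto
  qed (use B in auto)
  show thesis
  proof
    show "(\<lambda>x. cinner x w) \<in> dual UNIV"
      using restrict_cinner_in_dual[OF csubspace_UNIV, of w] by (simp add: restrict_UNIV)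
    show "cinner x w = f x" if "x \<in> L" for x
      using w(1)[of x] \<phi>[of x 0] that csubspace_0[OF M] by force
    show "cinner x w = 0" if "x \<in> M" for x
      using w(1)[of x] \<phi>[of 0 x] that csubspace_0[OF L] dual_0[OF L fd] by force
    show "dual_norm UNIV (\<lambda>x. cinner x w) \<le> B"
    proof (rule dual_norm_le)
      fix x :: 'a
      have "norm x * norm w \<le> norm x * B" by (rule mult_left_mono) (use w(2) in auto)
      then show "cmod (cinner x w) \<le> B * norm x"
        using cinner_Cauchy_Schwarz[of x w] by (simp add: mult.commute)
    qed (use B in auto)
  qed
qed

lemma dual_norm_F_Q_nonneg: "csubspace L \<Longrightarrow> f \<in> F_Q L M \<Longrightarrow> 0 \<le> dual_norm L f"
  by (simp add: F_Q_def dual_norm_nonneg)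

text \<open>Membership in \<open>F_M\<close> only provides some \<open>f'\<close> that
  \<open>g\<close> extends. Since \<open>f\<close> and \<open>f'\<close> agree on \<open>L\<close>
  and are both extensional, they coincide, and the norm estimate becomes one for
  \<open>f\<close>.\<close>

lemma F_M_extensionD:
  assumes "f \<in> F_Q L M" "g \<in> F_M L M A" "\<forall>x\<in>L. g x = f x"
  shows "g \<in> dual UNIV" "\<And>x. x \<in> M \<Longrightarrow> g x = 0" "dual_norm UNIV g \<le> A * dual_norm L f"
proof -
  obtain f' where f': "f' \<in> F_Q L M" "\<And>x. x \<in> L \<Longrightarrow> g x = f' x"
    "dual_norm UNIV g \<le> A * dual_norm L f'"
    using assms(2) by (auto simp: F_M_def)
  have "f' = f"
  proof (rule extensionalityI[of f' L f])
    show "f' \<in> extensional L" "f \<in> extensional L"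
      using f'(1) assms(1) by (simp_all add: F_Q_def dual_def)
    show "f' x = f x" if "x \<in> L" for x
      using f'(2)[OF that] bspec[OF assms(3) that] by simp
  qed
  with f' show "dual_norm UNIV g \<le> A * dual_norm L f" by simp
qed (use assms(2) in \<open>auto simp: F_M_def\<close>)

text \<open>An extension \<open>g\<close> vanishes on \<open>M\<close>, so
  \<open>f u = g (u + v)\<close>.\<close>

lemma admissible_imp_bound:
  fixes L M :: "'a::complex_hilbert set"
  assumes "admissible L M A" "f \<in> F_Q L M" "u \<in> L" "v \<in> M"
  shows "cmod (f u) \<le> A * dual_norm L f * norm (u + v)"
proof -
  obtain g where g: "g \<in> F_M L M A" "\<forall>x\<in>L. g x = f x"
    using assms(1,2) unfolding admissible_def by fast
  note g' = F_M_extensionD[OF assms(2) g]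
  have "f u = g (u + v)"
    using bspec[OF g(2) assms(3)] g'(2)[OF assms(4)] dual_add[OF g'(1), of u v] by simp
  then have "cmod (f u) \<le> dual_norm UNIV g * norm (u + v)"
    using norm_le_dual_norm[OF csubspace_UNIV g'(1)] by simp
  also have "\<dots> \<le> A * dual_norm L f * norm (u + v)"
    using g'(3) by (intro mult_right_mono) auto
  finally show ?thesis .
qed

text \<open>Converse of \<open>admissible_imp_bound\<close>: each \<open>f\<close> is extended with
  \<open>B = A * dual_norm L f\<close>, and the map \<open>E\<close> arises by choice.\<close>

lemma bound_imp_admissible:
  fixes L M :: "'a::complex_hilbert set"
  assumes "csubspace L" "csubspace M" "0 \<le> A"
    and "\<And>f u v. f \<in> F_Q L M \<Longrightarrow> u \<in> L \<Longrightarrow> v \<in> M \<Longrightarrow> cmod (f u) \<le> A * dual_norm L f * norm (u + v)"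
  shows "admissible L M A"
proof -
  have "\<exists>g\<in>F_M L M A. \<forall>x\<in>L. g x = f x" if f: "f \<in> F_Q L M" for f
  proof -
    have "0 \<le> A * dual_norm L f"
      using assms(3) dual_norm_F_Q_nonneg[OF assms(1) f] by simp
    then obtain g where "g \<in> dual UNIV" "\<And>x. x \<in> L \<Longrightarrow> g x = f x" "\<And>x. x \<in> M \<Longrightarrow> g x = 0"
      "dual_norm UNIV g \<le> A * dual_norm L f"
      using extension_exists[OF assms(1,2) f] assms(4)[OF f] by blast
    with f show ?thesis by (auto simp: F_M_def)
  qed
  then obtain E where "\<forall>f\<in>F_Q L M. E f \<in> F_M L M A \<and> (\<forall>x\<in>L. E f x = f x)"
    by metis
  then show ?thesis unfolding admissible_def by blast
qed

text \<open>The test functional \<open>cinner _ u\<close> lies in \<open>F_Q\<close> because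
  \<open>u\<close> is orthogonal to \<open>L \<inter> M\<close>, and its norm on \<open>L\<close> is
  exactly \<open>norm u\<close>, attained at \<open>u\<close>.\<close>

lemma admissible_imp_norm_le:
  fixes L M :: "'a::complex_hilbert set"
  assumes L: "csubspace L" and M: "csubspace M" and A: "admissible L M A"
    and u: "u \<in> L \<ominus> (L \<inter> M)" "u \<noteq> 0"
  shows "1 \<le> A" "v \<in> M \<Longrightarrow> norm u \<le> A * norm (u + v)"
proof -
  define f where "f = restrict (\<lambda>x. cinner x u) L"
  have orth: "cinner x u = 0" if "x \<in> L \<inter> M" for x
    using u(1) that cinner_commute[of x u] by (auto simp: ominus_def)
  have uL: "u \<in> L" using u(1) by (simp add: ominus_def)
  have f: "f \<in> F_Q L M"
    using restrict_cinner_in_dual[OF L] orth by (auto simp: F_Q_def f_def)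
  have f_u: "cmod (f u) = norm u * norm u"
    using uL by (simp add: f_def cinner_self power2_eq_square norm_mult)
  have "dual_norm L f \<le> norm u"
    using uL cinner_Cauchy_Schwarz[of _ u]
    by (intro dual_norm_le) (auto simp: f_def mult.commute)
  moreover have "norm u * norm u \<le> dual_norm L f * norm u"
    using norm_le_dual_norm[OF L _ uL, of f] f f_u by (simp add: F_Q_def)
  ultimately have norm_f: "dual_norm L f = norm u" using u(2) by simp
  have *: "norm u \<le> A * norm (u + v)" if "v \<in> M" for v
  proof -
    have "norm u * norm u \<le> norm u * (A * norm (u + v))"
      using admissible_imp_bound[OF A f uL that] by (simp add: f_u norm_f mult_ac)
    with u(2) show ?thesis by simp
  qed
  show "v \<in> M \<Longrightarrow> norm u \<le> A * norm (u + v)" by (rule *)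
  \<comment> \<open>The case \<open>v = 0\<close>.\<close>
  show "1 \<le> A" using *[OF csubspace_0[OF M]] u(2) by simp
qed

section \<open>The inclination and the optimal estimate\<close>

lemma inclination_upper:
  fixes L M :: "'a::complex_hilbert set"
  assumes "u \<in> L \<ominus> (L \<inter> M)" "v \<in> M \<ominus> (L \<inter> M)"
  shows "cmod (cinner u v) \<le> inclination L M * (norm u * norm v)"
proof (cases "u = 0 \<or> v = 0")
  case False
  have "cmod (cinner u v) / (norm u * norm v) \<le> inclination L M"
    unfolding inclination_def
  proof (rule cSup_upper)
    show "bdd_above {cmod (cinner u v) / (norm u * norm v) |u v.
          u \<in> L \<ominus> (L \<inter> M) \<and> u \<noteq> 0 \<and> v \<in> M \<ominus> (L \<inter> M) \<and> v \<noteq> 0}"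
      \<comment> \<open>By Cauchy-Schwarz all quotients are at most \<open>1\<close>.\<close>
      by (rule bdd_aboveI[of _ 1]) (auto simp: divide_le_eq_1 cinner_Cauchy_Schwarz)
  qed (use False assms in blast)
  with False show ?thesis by (simp add: field_simps)
qed auto

lemma inclination_bound:
  fixes L M :: "'a::complex_hilbert set"
  assumes L: "csubspace L" "closed L" and M: "csubspace M" "closed M"
    and c: "0 \<le> inclination L M" "inclination L M < 1"
    and f: "f \<in> F_Q L M" and u: "u \<in> L" and v: "v \<in> M"
  shows "cmod (f u) \<le> 1 / sqrt (1 - (inclination L M)\<^sup>2) * dual_norm L f * norm (u + v)"
proof -
  let ?Q = "L \<inter> M" and ?c = "inclination L M"
  have Q: "csubspace ?Q" "closed ?Q" using L M by (auto simp: csubspace_Int)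
  obtain p where p: "p \<in> ?Q" "u - p \<in> L \<ominus> ?Q"
    using orthogonal_decomposition[OF L(1) Q _ u] by blast
  obtain q where q: "q \<in> ?Q" "v - q \<in> M \<ominus> ?Q"
    using orthogonal_decomposition[OF M(1) Q _ v] by blast
  define x where "x = u - p"
  define y where "y = v - q"
  have c1: "0 < 1 - ?c\<^sup>2" using c by (simp add: power_less_one_iff abs_square_less_1)
  \<comment> \<open>The part \<open>p + q\<close> in \<open>?Q\<close> is orthogonal to
    \<open>x + y\<close>, so dropping it does not increase the norm.\<close>
  have "p + q \<in> ?Q" using p(1) q(1) Q(1) csubspace_add by blast
  then have "cinner (x + y) (p + q) = 0"
    using p(2) q(2) by (simp add: ominus_def x_def y_def cinner_add_left)
  moreover have "u + v = (x + y) + (p + q)" by (simp add: x_def y_def)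
  ultimately have "(norm (x + y))\<^sup>2 \<le> (norm (u + v))\<^sup>2"
    using norm_add_sq_orthogonal by (metis le_add_same_cancel1 zero_le_power2)
  \<comment> \<open>With \<open>?c\<close> bounding the cosine,
    \<open>(norm (x + y))\<^sup>2\<close> is at least \<open>(1 - ?c\<^sup>2) * (norm x)\<^sup>2 +
    (norm y - ?c * norm x)\<^sup>2\<close>.\<close>
  moreover have "(1 - ?c\<^sup>2) * (norm x)\<^sup>2 \<le> (norm (x + y))\<^sup>2"
  proof -
    have "- Re (cinner x y) \<le> ?c * (norm x * norm y)"
      using inclination_upper[OF p(2) q(2)] abs_Re_le_cmod[of "cinner x y"]
      by (simp add: x_def y_def)
    moreover have "0 \<le> (norm y - ?c * norm x)\<^sup>2" by simp
    ultimately show ?thesis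
      by (simp add: norm_add_sq power2_diff power_mult_distrib algebra_simps)
  qed
  ultimately have "(1 - ?c\<^sup>2) * (norm x)\<^sup>2 \<le> (norm (u + v))\<^sup>2"
    by (rule order_trans[rotated])
  then have "(norm x)\<^sup>2 \<le> (norm (u + v))\<^sup>2 / (1 - ?c\<^sup>2)"
    using c1 by (subst pos_le_divide_eq) (simp_all add: mult.commute)
  then have "norm x \<le> sqrt ((norm (u + v))\<^sup>2 / (1 - ?c\<^sup>2))"
    by (rule real_le_rsqrt)
  then have x_le: "norm x \<le> norm (u + v) / sqrt (1 - ?c\<^sup>2)"
    by (simp add: real_sqrt_divide)
  have fd: "f \<in> dual L" "f p = 0" using f p(1) by (auto simp: F_Q_def)
  have xL: "x \<in> L" using p(2) by (simp add: x_def ominus_def)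
  have "f u = f x"
    using dual_diff[OF L(1) fd(1) u, of p] p(1) fd(2) by (simp add: x_def)
  then have "cmod (f u) \<le> dual_norm L f * norm x"
    using norm_le_dual_norm[OF L(1) fd(1) xL] by simp
  also have "\<dots> \<le> dual_norm L f * (norm (u + v) / sqrt (1 - ?c\<^sup>2))"
    using x_le dual_norm_nonneg[OF L(1) fd(1)] by (rule mult_left_mono)
  finally show ?thesis by simp
qed

lemma admissible_imp_inclination_less_1:
  fixes L M :: "'a::complex_hilbert set"
  assumes L: "csubspace L" and M: "csubspace M" and A: "admissible L M A"
    and ne: "u\<^sub>0 \<in> L \<ominus> (L \<inter> M)" "u\<^sub>0 \<noteq> 0" "v\<^sub>0 \<in> M \<ominus> (L \<inter> M)" "v\<^sub>0 \<noteq> 0"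
  shows "inclination L M < 1"
proof -
  have A1: "1 \<le> A" using admissible_imp_norm_le(1)[OF L M A ne(1,2)] .
  have "cmod (cinner u v) / (norm u * norm v) \<le> sqrt (1 - 1 / A\<^sup>2)"
    if u: "u \<in> L \<ominus> (L \<inter> M)" "u \<noteq> 0" and v: "v \<in> M \<ominus> (L \<inter> M)" "v \<noteq> 0" for u v
  proof -
    \<comment> \<open>Among the multiples of \<open>v\<close>, the projection \<open>p\<close> is
      closest to \<open>u\<close>, so \<open>- p\<close> gives the strongest instance of the
      estimate.\<close>
    define p where "p = (cinner u v / of_real ((norm v)\<^sup>2)) *\<^sub>C v"
    have "v \<in> M" using v(1) by (simp add: ominus_def)
    then have "- p \<in> M" using M by (simp add: p_def csubspace_scaleC csubspace_uminus)
    then have "norm u \<le> A * norm (u - p)"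
      using admissible_imp_norm_le(2)[OF L M A u] by fastforce
    then have "(norm u)\<^sup>2 \<le> A\<^sup>2 * (norm (u - p))\<^sup>2"
      using power_mono[of "norm u" "A * norm (u - p)" 2] by (simp add: power_mult_distrib)
    also have "\<dots> = A\<^sup>2 * ((norm u)\<^sup>2 - (cmod (cinner u v) / norm v)\<^sup>2)"
      unfolding p_def norm_sq_diff_projection[OF v(2)] ..
    finally have "(cmod (cinner u v) / norm v)\<^sup>2 \<le> (1 - 1 / A\<^sup>2) * (norm u)\<^sup>2"
      using A1 by (simp add: field_simps)
    then have "(cmod (cinner u v) / norm v)\<^sup>2 / (norm u)\<^sup>2 \<le> 1 - 1 / A\<^sup>2"
      using u(2) by (subst pos_divide_le_eq) simp_all
    then have "(cmod (cinner u v) / (norm u * norm v))\<^sup>2 \<le> 1 - 1 / A\<^sup>2"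
      by (simp add: power_divide power_mult_distrib mult.commute)
    then show ?thesis by (rule real_le_rsqrt)
  qed
  \<comment> \<open>The bound is uniform in \<open>u\<close> and \<open>v\<close>, so it passes to
    the supremum and stays strictly below \<open>1\<close>.\<close>
  then have "inclination L M \<le> sqrt (1 - 1 / A\<^sup>2)"
    unfolding inclination_def using ne by (intro cSup_least) blast+
  also have "\<dots> < 1" using A1 by simp
  finally show ?thesis .
qed

section \<open>The criterion and the least constant\<close>

theorem theorem2p1:
  fixes L M :: "'a::complex_hilbert set"
  assumes "csubspace L" and "closed L" and "csubspace M" and "closed M"
    and "L \<ominus> (L \<inter> M) \<noteq> {0}" and "M \<ominus> (L \<inter> M) \<noteq> {0}"
  shows "((\<exists>A. admissible L M A) \<longleftrightarrow> inclination L M < 1) \<and>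
    (inclination L M < 1 \<longrightarrow>
      admissible L M (ext_const L M) \<and>
      (\<forall>f\<in>F_Q L M. \<forall>g\<in>F_M L M (ext_const L M). (\<forall>x\<in>L. g x = f x) \<longrightarrow>
        dual_norm UNIV g \<le> 1 / sqrt (1 - (inclination L M)\<^sup>2) * dual_norm L f) \<and>
      (\<forall>A. \<forall>f\<in>F_Q L M. \<forall>g\<in>F_M L M A. (\<forall>x\<in>L. g x = f x) \<longrightarrow>
        dual_norm {u + v |u v. u \<in> L \<and> v \<in> M} g
          \<le> 1 / sqrt (1 - (inclination L M)\<^sup>2) * dual_norm L f))"
proof -
  let ?Q = "L \<inter> M" and ?c = "inclination L M"
  let ?K = "1 / sqrt (1 - ?c\<^sup>2)"
  note L = assms(1,2) and M = assms(3,4)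
  have "0 \<in> L \<ominus> ?Q" "0 \<in> M \<ominus> ?Q"
    using L M by (simp_all add: ominus_def csubspace_0)
  with assms(5,6) obtain u\<^sub>0 v\<^sub>0 where u0: "u\<^sub>0 \<in> L \<ominus> ?Q" "u\<^sub>0 \<noteq> 0" and v0: "v\<^sub>0 \<in> M \<ominus> ?Q" "v\<^sub>0 \<noteq> 0"
    by blast
  have "0 \<le> ?c * (norm u\<^sub>0 * norm v\<^sub>0)"
    using inclination_upper[OF u0(1) v0(1)] norm_ge_zero order_trans by blast
  moreover have "0 < norm u\<^sub>0 * norm v\<^sub>0" using u0(2) v0(2) by simp
  ultimately have c0: "0 \<le> ?c"
    by (simp only: zero_le_mult_iff) linarith
  have ge_1: "1 \<le> A" if "admissible L M A" for A
    using admissible_imp_norm_le(1)[OF L(1) M(1) that u0] .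
  have lt_1: "?c < 1" if A: "admissible L M A" for A
    using admissible_imp_inclination_less_1[OF L(1) M(1) A u0 v0] .
  have K: "admissible L M ?K" "0 \<le> ?K" if "?c < 1"
  proof -
    show "0 \<le> ?K" using c0 that by (simp add: power_le_one)
    then show "admissible L M ?K"
      using bound_imp_admissible[OF L(1) M(1)] inclination_bound[OF L M c0 that] by blast
  qed
  \<comment> \<open>For fixed \<open>f\<close>, \<open>u\<close>, \<open>v\<close> the estimate is a
    closed condition on \<open>A\<close>, so the infimum of the admissible constants satisfies it
    and is itself admissible.\<close>
  have ext: "admissible L M (ext_const L M)" "ext_const L M \<le> ?K" if c: "?c < 1"
  proof -
    have ne: "{A. admissible L M A} \<noteq> {}" using K(1)[OF c] by blast
    have bdd: "bdd_below {A. admissible L M A}"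
      using ge_1 by (intro bdd_belowI[of _ 1]) simp
    show "ext_const L M \<le> ?K"
      unfolding ext_const_def using K(1)[OF c] bdd by (simp add: cInf_lower)
    have "1 \<le> ext_const L M"
      unfolding ext_const_def using ne ge_1 by (auto intro: cInf_greatest)
    then show "admissible L M (ext_const L M)"
    proof (intro bound_imp_admissible[OF L(1) M(1)])
      fix f u v assume f: "f \<in> F_Q L M" and uv: "u \<in> L" "v \<in> M"
      define b where "b = dual_norm L f * norm (u + v)"
      have b: "cmod (f u) \<le> A * b" if "admissible L M A" for A
        using admissible_imp_bound[OF that f uv] by (simp add: b_def mult.assoc)
      have "0 \<le> b"
        using dual_norm_F_Q_nonneg[OF L(1) f] by (simp add: b_def)
      have "cmod (f u) \<le> ext_const L M * b"
      \<comment> \<open>For \<open>b = 0\<close> division is impossible, but then the estimate with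
        \<open>?K\<close> already forces \<open>f u = 0\<close>.\<close>
      proof (cases "b = 0")
        case True
        with b K(1)[OF c] show ?thesis by fastforce
      next
        case False
        with \<open>0 \<le> b\<close> have "0 < b" by simp
        then have "cmod (f u) / b \<le> ext_const L M"
          unfolding ext_const_def using ne b
          by (intro cInf_greatest) (auto simp: pos_divide_le_eq)
        with \<open>0 < b\<close> show ?thesis by (simp add: pos_divide_le_eq)
      qed
      then show "cmod (f u) \<le> ext_const L M * dual_norm L f * norm (u + v)"
        by (simp add: b_def mult.assoc)
    qed simp
  qed
  have best: "dual_norm UNIV g \<le> ?K * dual_norm L f"
    if "?c < 1" and f: "f \<in> F_Q L M" and "g \<in> F_M L M (ext_const L M)" "\<forall>x\<in>L. g x = f x" for f g
  proof -
    have "dual_norm UNIV g \<le> ext_const L M * dual_norm L f"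
      using F_M_extensionD(3)[OF f] that by blast
    also have "\<dots> \<le> ?K * dual_norm L f"
      using ext(2)[OF that(1)] dual_norm_F_Q_nonneg[OF L(1) f] by (rule mult_right_mono)
    finally show ?thesis .
  qed
  \<comment> \<open>On \<open>L + M\<close> an extension is determined by \<open>f\<close>, so the
    bound holds there whatever \<open>A\<close> is.\<close>
  have sum: "dual_norm {u + v |u v. u \<in> L \<and> v \<in> M} g \<le> ?K * dual_norm L f"
    if c: "?c < 1" and f: "f \<in> F_Q L M" and g: "g \<in> F_M L M A" "\<forall>x\<in>L. g x = f x" for f g A
  proof (rule dual_norm_le)
    show "{u + v |u v. u \<in> L \<and> v \<in> M} \<noteq> {}"
      using L M csubspace_0 by blast
    show "0 \<le> ?K * dual_norm L f"
      using K(2)[OF c] dual_norm_F_Q_nonneg[OF L(1) f] by (rule mult_nonneg_nonneg)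
    fix x assume "x \<in> {u + v |u v. u \<in> L \<and> v \<in> M}"
    then obtain u v where uv: "x = u + v" "u \<in> L" "v \<in> M" by blast
    have g': "g \<in> dual UNIV" "\<And>x. x \<in> M \<Longrightarrow> g x = 0"
      using F_M_extensionD[OF f g(1)] g(2) by blast+
    then have "g x = f u"
      using dual_add[OF g'(1), of u v] g(2) uv by simp
    with inclination_bound[OF L M c0 c f uv(2,3)] uv(1)
    show "cmod (g x) \<le> ?K * dual_norm L f * norm x" by simp
  qed
  from lt_1 K(1) ext(1) best sum show ?thesis by blast
qed

end
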